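(* Let $\{(X_k,d_k)\}_{k=1}^\infty$ be a countable family of metric spaces, each with at least two points, such that $\mathrm{diam}(X_k)<\infty$ for all but finitely many $k$. Let $X=\prod_{k}X_k$ and, for $x=(x_k),y=(y_k)\in X$, let $$D(x,y)=\sum_{k=1}^\infty \frac{d_k(x_k,y_k)}{\lambda_k 2^k},$$ where $\lambda_k=1$ if $\mathrm{diam}(X_k)=\infty$ and $\lambda_k=\mathrm{diam}(X_k)$ if $\mathrm{diam}(X_k)<\infty$. If the metric $d_k$ is sleek for $X_k$ for all $k$, then the metric $D$ is sleek for $X$. The converse is not true: there exists such a family $\{(X_k,d_k)\}_{k=1}^\infty$ for which $D$ is sleek for $X$ but $d_k$ is not sleek for $X_k$ for some $k$.
   Context: For a metric space $(X,d)$, $x\in X$ and $r>0$, let $B_d(x,r)=\{y\in X: d(x,y)<r\}$ and $B_d[x,r]=\{y\in X: d(x,y)\le r\}$ be the open and closed balls, and let $B_d^\circ[x,r]$ be the interior of $B_d[x,r]$ in $X$. The metric $d$ is sleek for $X$ if $B_d^\circ[x,r]=B_d(x,r)$ for all $x\in X$ and all $r>0$. The function $D$ is a metric on $\prod_k X_k$ inducing the product topology (known). *)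

theory Defs
  imports "HOL-Analysis.Analysis"
begin

definition diam :: "'a set \<Rightarrow> ('a \<Rightarrow> 'a \<Rightarrow> real) \<Rightarrow> ereal" where
  "diam X d = (SUP x\<in>X. SUP y\<in>X. ereal (d x y))"

text \<open>Meaningful only for pairs with \<^prop>\<open>Metric_space X d\<close>.\<close>

definition sleek :: "'a set \<Rightarrow> ('a \<Rightarrow> 'a \<Rightarrow> real) \<Rightarrow> bool" where
  "sleek X d \<longleftrightarrow>
    (\<forall>x\<in>X. \<forall>r>0. Metric_space.mtopology X d interior_of Metric_space.mcball X d x r
                 = Metric_space.mball X d x r)"

definition diam_weight :: "'a set \<Rightarrow> ('a \<Rightarrow> 'a \<Rightarrow> real) \<Rightarrow> real" where
  "diam_weight X d = (if diam X d = \<infinity> then 1 else real_of_ereal (diam X d))"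

text \<open>The family is indexed from \<open>0\<close>, so the factor with index \<open>k\<close> carries the
  weight \<open>2 ^ Suc k\<close>. The locale \<^locale>\<open>Metric_space\<close> demands nonnegativity and symmetry on
  the whole type, and outside the product the series need not converge, so the value there is
  fixed to be \<open>0\<close>.\<close>

definition series_metric ::
  "(nat \<Rightarrow> 'a set) \<Rightarrow> (nat \<Rightarrow> 'a \<Rightarrow> 'a \<Rightarrow> real) \<Rightarrow> (nat \<Rightarrow> 'a) \<Rightarrow> (nat \<Rightarrow> 'a) \<Rightarrow> real" where
  "series_metric X d x y =
    (if x \<in> (\<Pi>\<^sub>E k\<in>UNIV. X k) \<and> y \<in> (\<Pi>\<^sub>E k\<in>UNIV. X k)
     then \<Sum>k. d k (x k) (y k) / (diam_weight (X k) (d k) * 2 ^ Suc k)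
     else 0)"

locale metric_family =
  fixes X :: "nat \<Rightarrow> 'a set" and d :: "nat \<Rightarrow> 'a \<Rightarrow> 'a \<Rightarrow> real"
  assumes metric: "\<And>k. Metric_space (X k) (d k)"
    and two_points: "\<And>k. \<exists>a\<in>X k. \<exists>b\<in>X k. a \<noteq> b"
    and finite_unbounded: "finite {k. diam (X k) (d k) = \<infinity>}"
begin

lemma le_diam:
  assumes "a \<in> X k" "b \<in> X k"
  shows "ereal (d k a b) \<le> diam (X k) (d k)"
  unfolding diam_def using assms by (meson SUP_upper2 order_refl)

lemma diam_weight_pos: "diam_weight (X k) (d k) > 0"
proof -
  obtain a b where ab: "a \<in> X k" "b \<in> X k" "a \<noteq> b" using two_points by blast
  have "d k a b > 0"
    using Metric_space.mdist_pos_less[OF metric] ab by metis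
  with le_diam[OF ab(1,2)] show ?thesis
    by (cases "diam (X k) (d k)") (auto simp: diam_weight_def)
qed

lemma le_diam_weight:
  assumes "diam (X k) (d k) \<noteq> \<infinity>" "a \<in> X k" "b \<in> X k"
  shows "d k a b \<le> diam_weight (X k) (d k)"
  using le_diam[OF assms(2,3)] assms(1)
  by (cases "diam (X k) (d k)") (auto simp: diam_weight_def)

lemma term_nonneg: "0 \<le> d k a b / (diam_weight (X k) (d k) * 2 ^ Suc k)"
  using Metric_space.nonneg[OF metric, of k a b] diam_weight_pos[of k] by simp

lemma summable_series_metric:
  assumes "x \<in> (\<Pi>\<^sub>E k\<in>UNIV. X k)" "y \<in> (\<Pi>\<^sub>E k\<in>UNIV. X k)"
  shows "summable (\<lambda>k. d k (x k) (y k) / (diam_weight (X k) (d k) * 2 ^ Suc k))"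
proof -
  obtain N where "\<forall>k\<in>{k. diam (X k) (d k) = \<infinity>}. k < N"
    using finite_unbounded unfolding finite_nat_set_iff_bounded by blast
  then have N: "diam (X k) (d k) \<noteq> \<infinity>" if "k \<ge> N" for k
    using that by (meson leD mem_Collect_eq)
  show ?thesis
  proof (rule summable_comparison_test')
    show "summable (\<lambda>k. (1 / 2 :: real) ^ k)"
      by (rule summable_geometric) simp
    fix k assume "N \<le> k"
    then have "d k (x k) (y k) \<le> diam_weight (X k) (d k)"
      using le_diam_weight[OF N] assms by (auto simp: PiE_iff)
    then have "d k (x k) (y k) / diam_weight (X k) (d k) / 2 ^ Suc k \<le> 1 / 2 ^ Suc k"
      using diam_weight_pos[of k] by (intro divide_right_mono) auto
    also have "\<dots> \<le> (1 / 2 :: real) ^ k"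
      by (simp add: power_divide field_simps)
    finally show "norm (d k (x k) (y k) / (diam_weight (X k) (d k) * 2 ^ Suc k)) \<le> (1 / 2) ^ k"
      using term_nonneg[of k "x k" "y k"] by simp
  qed
qed

lemma Metric_space_series_metric: "Metric_space (\<Pi>\<^sub>E k\<in>UNIV. X k) (series_metric X d)"
proof
  fix x y
  show "0 \<le> series_metric X d x y"
    using suminf_nonneg[OF summable_series_metric term_nonneg] by (simp add: series_metric_def)
  show "series_metric X d x y = series_metric X d y x"
    using Metric_space.commute[OF metric] by (auto simp: series_metric_def)
next
  fix x y
  assume xy: "x \<in> (\<Pi>\<^sub>E k\<in>UNIV. X k)" "y \<in> (\<Pi>\<^sub>E k\<in>UNIV. X k)"
  have "series_metric X d x y = 0 \<longleftrightarrow>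
      (\<forall>k. d k (x k) (y k) / (diam_weight (X k) (d k) * 2 ^ Suc k) = 0)"
    using suminf_eq_zero_iff[OF summable_series_metric[OF xy] term_nonneg] xy
    by (simp add: series_metric_def)
  also have "\<dots> \<longleftrightarrow> (\<forall>k. d k (x k) (y k) = 0)"
    using diam_weight_pos by (simp add: less_imp_neq[symmetric])
  also have "\<dots> \<longleftrightarrow> (\<forall>k. x k = y k)"
    using Metric_space.zero[OF metric] xy by (simp add: PiE_iff)
  finally show "series_metric X d x y = 0 \<longleftrightarrow> x = y"
    by auto
next
  fix x y z
  assume xyz: "x \<in> (\<Pi>\<^sub>E k\<in>UNIV. X k)" "y \<in> (\<Pi>\<^sub>E k\<in>UNIV. X k)" "z \<in> (\<Pi>\<^sub>E k\<in>UNIV. X k)"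
  let ?t = "\<lambda>x y k. d k (x k) (y k) / (diam_weight (X k) (d k) * 2 ^ Suc k)"
  have "?t x z k \<le> ?t x y k + ?t y z k" for k
  proof -
    have "d k (x k) (z k) \<le> d k (x k) (y k) + d k (y k) (z k)"
      using xyz by (intro Metric_space.triangle[OF metric]) (auto simp: PiE_iff)
    then show ?thesis
      using diam_weight_pos[of k] by (simp add: add_divide_distrib[symmetric] divide_right_mono)
  qed
  then have "(\<Sum>k. ?t x z k) \<le> (\<Sum>k. ?t x y k + ?t y z k)"
    using xyz by (intro suminf_le summable_add summable_series_metric)
  also have "\<dots> = (\<Sum>k. ?t x y k) + (\<Sum>k. ?t y z k)"
    using xyz by (intro suminf_add[symmetric] summable_series_metric)
  finally show "series_metric X d x z \<le> series_metric X d x y + series_metric X d y z"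
    using xyz by (simp add: series_metric_def)
qed

end

end

theory Submission
  imports Defs
begin

text \<open>
  A metric is sleek iff from every point \<open>y\<close> one can move, by an arbitrarily small step, strictly
  further away from any other given point \<open>x\<close> (\<open>sleek_iff_escape\<close>). The series metric is a sum of
  positive multiples of the factor metrics, so changing a single coordinate of \<open>y\<close> changes the
  distance to \<open>x\<close> by a multiple of what happens in that factor. Hence for two points \<open>x \<noteq> y\<close> of the
  product it suffices that such a small step exists in one coordinate
  (\<open>sleek_series_metric_if_coordinate_escape\<close>). If all factors are sleek, any coordinate in which
  \<open>x\<close> and \<open>y\<close> differ will do.

  The coordinate used need not be one in which \<open>x\<close> and \<open>y\<close> differ: in the real line one can step away
  from \<open>x\<close> even when starting at \<open>x\<close> itself. A single factor \<open>\<real>\<close> therefore makes the product sleek,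
  whatever the other factors are; with the two-point set \<open>{0, 1}\<close>, which is not sleek because \<open>1\<close> is
  isolated, as every other factor, this refutes the converse.
\<close>

text \<open>The closed ball always has the open ball inside its interior, so sleekness only says that no
  point on the sphere is interior to the closed ball. Letting the centre and the radius range over
  everything turns this into a condition on pairs of points.\<close>

lemma sleek_iff_escape:
  assumes "Metric_space X d"
  shows "sleek X d \<longleftrightarrow>
    (\<forall>x\<in>X. \<forall>y\<in>X. x \<noteq> y \<longrightarrow> (\<forall>e>0. \<exists>z\<in>X. d y z < e \<and> d x y < d x z))"
    (is "_ \<longleftrightarrow> ?escape")
proof -
  interpret Metric_space X d by fact
  show ?thesis
  proof
    assume sleek: "sleek X d"
    show ?escape
    proof (intro ballI impI allI)
      fix x y and e :: real
      assume xy: "x \<in> X" "y \<in> X" "x \<noteq> y" and e: "e > 0"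
      show "\<exists>z\<in>X. d y z < e \<and> d x y < d x z"
      proof (rule ccontr)
        assume "\<not> ?thesis"
        then have "d x z \<le> d x y" if "z \<in> X" "d y z < e" for z
          using that by (force simp: not_less)
        then have "mball y e \<subseteq> mcball x (d x y)"
          using xy by auto
        then have "y \<in> mtopology interior_of mcball x (d x y)"
          using xy e interior_of_maximal[OF _ openin_mball] by (meson centre_in_mball_iff subsetD)
        moreover have "d x y > 0"
          using xy by (simp add: mdist_pos_less)
        ultimately have "y \<in> mball x (d x y)"
          using sleek xy by (auto simp: sleek_def)
        then show False
          by simp
      qed
    qed
  next
    assume escape: ?escape
    show "sleek X d"
      unfolding sleek_def
    proof (intro ballI allI impI subset_antisym subsetI)
      fix x r y
      assume x: "x \<in> X" and r: "(r :: real) > 0"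
      {
        assume y: "y \<in> mtopology interior_of mcball x r"
        obtain e where e: "e > 0" "mball y e \<subseteq> mcball x r"
          using y openin_interior_of[of mtopology "mcball x r"]
            interior_of_subset[of mtopology "mcball x r"]
          unfolding openin_mtopology by (meson subset_trans)
        have y_ball: "y \<in> mcball x r"
          using y interior_of_subset[of mtopology "mcball x r"] by (rule subsetD[rotated])
        have "d x y \<noteq> r"
        proof
          assume "d x y = r"
          moreover from this r x have "x \<noteq> y"
            by auto
          ultimately obtain z where "z \<in> X" "d y z < e" "r < d x z"
            using escape x y_ball e(1) in_mcball by blast
          then show False
            using e(2) y_ball by (auto simp: subset_iff)
        qed
        then show "y \<in> mball x r"
          using y_ball by simp
      next
        assume "y \<in> mball x r"
        then show "y \<in> mtopology interior_of mcball x r"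
          using interior_of_maximal[OF mball_subset_mcball openin_mball] by blast
      }
    qed
  qed
qed

context metric_family
begin

text \<open>Only one summand of the series changes, so both the length of the step and the gain in
  distance are those of coordinate \<open>k\<close>, divided by the weight of that coordinate.\<close>

lemma series_metric_fun_upd:
  assumes x: "x \<in> (\<Pi>\<^sub>E k\<in>UNIV. X k)" and y: "y \<in> (\<Pi>\<^sub>E k\<in>UNIV. X k)" and c: "c \<in> X k"
  shows "series_metric X d x (y(k := c)) =
    series_metric X d x y
      + (d k (x k) c - d k (x k) (y k)) / (diam_weight (X k) (d k) * 2 ^ Suc k)"
proof -
  let ?w = "\<lambda>i. diam_weight (X i) (d i) * 2 ^ Suc i"
  let ?gain = "\<lambda>i. if i = k then (d k (x k) c - d k (x k) (y k)) / ?w k else 0"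
  have z: "y(k := c) \<in> (\<Pi>\<^sub>E k\<in>UNIV. X k)"
    using y c by (auto simp: PiE_iff)
  have "(\<lambda>i. d i (x i) (y i) / ?w i) sums series_metric X d x y"
    using summable_sums[OF summable_series_metric[OF x y]] x y by (simp add: series_metric_def)
  moreover have "?gain sums ((d k (x k) c - d k (x k) (y k)) / ?w k)"
    by (rule sums_single)
  ultimately have "(\<lambda>i. d i (x i) (y i) / ?w i + ?gain i) sums
      (series_metric X d x y + (d k (x k) c - d k (x k) (y k)) / ?w k)"
    by (rule sums_add)
  moreover have "(\<lambda>i. d i (x i) (y i) / ?w i + ?gain i) = (\<lambda>i. d i (x i) ((y(k := c)) i) / ?w i)"
    by (auto simp: diff_divide_distrib)
  ultimately show ?thesis
    using x z by (simp add: series_metric_def sums_iff del: fun_upd_apply)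
qed

text \<open>The coordinate \<open>k\<close> may depend on \<open>x\<close> and \<open>y\<close>, and \<open>x k = y k\<close> is allowed. The first freedom
  serves the implication, the second one the counterexample to its converse.\<close>

lemma sleek_series_metric_if_coordinate_escape:
  assumes escape: "\<And>x y. \<lbrakk>x \<in> (\<Pi>\<^sub>E k\<in>UNIV. X k); y \<in> (\<Pi>\<^sub>E k\<in>UNIV. X k); x \<noteq> y\<rbrakk> \<Longrightarrow>
    \<exists>k. \<forall>e>0. \<exists>c\<in>X k. d k (y k) c < e \<and> d k (x k) (y k) < d k (x k) c"
  shows "sleek (\<Pi>\<^sub>E k\<in>UNIV. X k) (series_metric X d)"
  unfolding sleek_iff_escape[OF Metric_space_series_metric]
proof (intro ballI impI allI)
  fix x y and e :: real
  assume x: "x \<in> (\<Pi>\<^sub>E k\<in>UNIV. X k)" and y: "y \<in> (\<Pi>\<^sub>E k\<in>UNIV. X k)"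
    and neq: "x \<noteq> y" and e: "e > 0"
  obtain k where k: "\<And>e. e > 0 \<Longrightarrow> \<exists>c\<in>X k. d k (y k) c < e \<and> d k (x k) (y k) < d k (x k) c"
    using escape[OF x y neq] by blast
  define w where "w = diam_weight (X k) (d k) * 2 ^ Suc k"
  have w: "w > 0"
    using diam_weight_pos[of k] by (simp add: w_def)
  obtain c where c: "c \<in> X k" "d k (y k) c < e * w" "d k (x k) (y k) < d k (x k) c"
    using k[of "e * w"] e w by auto
  have "series_metric X d y (y(k := c)) = d k (y k) c / w"
    using series_metric_fun_upd[OF y y c(1)] y Metric_space.zero[OF metric]
      Metric_space.zero[OF Metric_space_series_metric y y]
    by (auto simp: w_def PiE_iff)
  also have "\<dots> < e"
    using c(2) w by (simp add: divide_less_eq)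
  finally have "series_metric X d y (y(k := c)) < e" .
  moreover have "series_metric X d x y < series_metric X d x (y(k := c))"
    using series_metric_fun_upd[OF x y c(1), folded w_def] c(3) w by (simp del: power_Suc)
  moreover have "y(k := c) \<in> (\<Pi>\<^sub>E k\<in>UNIV. X k)"
    using y c(1) by (auto simp: PiE_iff)
  ultimately show "\<exists>z\<in>\<Pi>\<^sub>E k\<in>UNIV. X k.
      series_metric X d y z < e \<and> series_metric X d x y < series_metric X d x z"
    by blast
qed

lemma sleek_series_metric:
  assumes "\<And>k. sleek (X k) (d k)"
  shows "sleek (\<Pi>\<^sub>E k\<in>UNIV. X k) (series_metric X d)"
proof (rule sleek_series_metric_if_coordinate_escape)
  fix x y
  assume x: "x \<in> (\<Pi>\<^sub>E k\<in>UNIV. X k)" and y: "y \<in> (\<Pi>\<^sub>E k\<in>UNIV. X k)" and "x \<noteq> y"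
  then obtain k where k: "x k \<noteq> y k"
    unfolding fun_eq_iff by blast
  have "x k \<in> X k" "y k \<in> X k"
    using x y by (auto simp: PiE_iff)
  then have "\<forall>e>0. \<exists>c\<in>X k. d k (y k) c < e \<and> d k (x k) (y k) < d k (x k) c"
    using assms[of k] k unfolding sleek_iff_escape[OF metric] by blast
  then show "\<exists>k. \<forall>e>0. \<exists>c\<in>X k. d k (y k) c < e \<and> d k (x k) (y k) < d k (x k) c" ..
qed

end

lemma Metric_space_dist: "Metric_space A dist"
  for A :: "'a :: metric_space set"
  by unfold_locales (auto simp: dist_commute dist_triangle)

lemma real_escape:
  fixes a b :: real
  assumes "e > 0"
  shows "\<exists>c. dist b c < e \<and> dist a b < dist a c"
proof (cases "a \<le> b")
  case True
  then show ?thesis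
    using assms by (intro exI[of _ "b + e / 2"]) (auto simp: dist_real_def)
next
  case False
  then show ?thesis
    using assms by (intro exI[of _ "b - e / 2"]) (auto simp: dist_real_def)
qed

lemma not_sleek_two_points: "\<not> sleek {0, 1 :: real} dist"
proof
  assume "sleek {0, 1 :: real} dist"
  then have "\<forall>e>0. \<exists>z\<in>{0, 1 :: real}. dist 1 z < e \<and> dist (0 :: real) 1 < dist 0 z"
    unfolding sleek_iff_escape[OF Metric_space_dist] by simp
  from this[rule_format, OF zero_less_one] show False
    by (simp add: dist_real_def)
qed

definition line_and_pairs :: "nat \<Rightarrow> real set" where
  "line_and_pairs k = (if k = 0 then UNIV else {0, 1})"

lemma metric_family_line_and_pairs: "metric_family line_and_pairs (\<lambda>_. dist)"
proof (rule metric_family.intro)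
  fix k :: nat
  show "Metric_space (line_and_pairs k) dist"
    by (rule Metric_space_dist)
  show "\<exists>a\<in>line_and_pairs k. \<exists>b\<in>line_and_pairs k. a \<noteq> b"
    by (rule bexI[of _ 0], rule bexI[of _ 1]) (auto simp: line_and_pairs_def)
next
  have "diam {0, 1 :: real} dist \<le> ereal 1"
    unfolding diam_def by (intro SUP_least) (auto simp: dist_real_def)
  then have "{k. diam (line_and_pairs k) dist = \<infinity>} \<subseteq> {0}"
    by (auto simp: line_and_pairs_def)
  then show "finite {k. diam (line_and_pairs k) dist = \<infinity>}"
    by (rule finite_subset) simp
qed

lemma sleek_line_and_pairs:
  "sleek (\<Pi>\<^sub>E k\<in>UNIV. line_and_pairs k) (series_metric line_and_pairs (\<lambda>_. dist))"
proof (rule metric_family.sleek_series_metric_if_coordinate_escape[OF metric_family_line_and_pairs])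
  fix x y :: "nat \<Rightarrow> real"
  show "\<exists>k. \<forall>e>0. \<exists>c\<in>line_and_pairs k. dist (y k) c < e \<and> dist (x k) (y k) < dist (x k) c"
    using real_escape by (intro exI[of _ 0]) (simp add: line_and_pairs_def)
qed

theorem theorem11:
  shows "(\<forall>(X :: nat \<Rightarrow> 'a set) d.
            metric_family X d \<longrightarrow> (\<forall>k. sleek (X k) (d k)) \<longrightarrow>
            sleek (\<Pi>\<^sub>E k\<in>UNIV. X k) (series_metric X d)) \<and>
         (\<exists>(X :: nat \<Rightarrow> real set) d.
            metric_family X d \<and>
            sleek (\<Pi>\<^sub>E k\<in>UNIV. X k) (series_metric X d) \<and>
            (\<exists>k. \<not> sleek (X k) (d k)))"
proof
  show "\<forall>(X :: nat \<Rightarrow> 'a set) d.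
            metric_family X d \<longrightarrow> (\<forall>k. sleek (X k) (d k)) \<longrightarrow>
            sleek (\<Pi>\<^sub>E k\<in>UNIV. X k) (series_metric X d)"
    using metric_family.sleek_series_metric by blast
  have "\<not> sleek (line_and_pairs 1) dist"
    using not_sleek_two_points by (simp add: line_and_pairs_def)
  then show "\<exists>(X :: nat \<Rightarrow> real set) d.
            metric_family X d \<and>
            sleek (\<Pi>\<^sub>E k\<in>UNIV. X k) (series_metric X d) \<and>
            (\<exists>k. \<not> sleek (X k) (d k))"
    using metric_family_line_and_pairs sleek_line_and_pairs by blast
qed

end
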